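(* Let $\langle L,\sqsubseteq,\bot,\sqcup\rangle$ be a CPO (every increasing chain, including the empty one, has a least upper bound in $L$) and let $f:L\to L$ be increasing. Let $P\in L$. Assume there is a transfinite sequence $(X^\delta)_{\delta\in\mathbb{O}}$ of elements of $L$ with $X^0=\bot$, $X^{\delta+1}\sqsubseteq f(X^\delta)$ for all ordinals $\delta$, and $X^\lambda\sqsubseteq\bigsqcup_{\beta<\lambda}X^\beta$ for all limit ordinals $\lambda$. Assume further there is a well-founded set $\langle W,\preceq\rangle$ and a function $\nu:\{X^\delta\mid\delta\in\mathbb{O}\}\to W$ such that for all ordinals $\beta<\delta$, $P\not\sqsubseteq X^\beta$ implies $\nu(X^\beta)\succ\nu(X^\delta)$. Then there exists $\delta<\omega$ with $P\sqsubseteq X^\delta\sqsubseteq f^\delta\sqsubseteq\mathrm{lfp}^{\sqsubseteq}f$.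
   Context: $\mathbb{O}$ is the class of ordinals and $\omega$ the first infinite ordinal. A set $W$ with a binary relation $\preceq$ is well-founded if it has no infinite strictly decreasing chain ($\succ$ denotes the strict converse). The transfinite iterates of $f$ from $\bot$ are $f^0=\bot$, $f^{\delta+1}=f(f^\delta)$, $f^\lambda=\bigsqcup_{\beta<\lambda}f^\beta$ for limit $\lambda$; $\mathrm{lfp}^{\sqsubseteq}f$ is the least fixpoint of $f$. *)

theory Defs
  imports Complex_Main "HOL-Library.Infinite_Typeclass"
begin

section \<open>Ordinals\<close>

text \<open>
  HOL has no type of all ordinals, so ordinals are relative to a bound: the elements of
  \<open>'i ordinal\<close> are the order types of the well-orders whose field is a subset of
  \<open>'i\<close>, that is, all ordinals of cardinality at most that of \<open>'i\<close>.  For infinite \<open>'i\<close>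
  they are closed under successor and contain the first infinite ordinal; both facts are
  proved below.  A statement about arbitrarily many ordinals is one with a free \<open>'i :: infinite\<close>.
\<close>

quotient_type 'i ordinal =
  "'i rel" / partial: "\<lambda>r s. Well_order r \<and> Well_order s \<and> (r, s) \<in> ordIso"
proof (rule part_equivpI)
  have "Well_order ({} :: 'i rel)" by simp
  then show "\<exists>r :: 'i rel. Well_order r \<and> Well_order r \<and> (r, r) \<in> ordIso"
    using ordIso_reflexive by blast
  show "symp (\<lambda>r s :: 'i rel. Well_order r \<and> Well_order s \<and> (r, s) \<in> ordIso)"
    by (auto intro!: sympI dest: ordIso_symmetric)
  show "transp (\<lambda>r s :: 'i rel. Well_order r \<and> Well_order s \<and> (r, s) \<in> ordIso)"
    by (auto intro!: transpI intro: ordIso_transitive)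
qed

instantiation ordinal :: (type) wellorder
begin

lift_definition less_eq_ordinal :: "'a ordinal \<Rightarrow> 'a ordinal \<Rightarrow> bool"
  is "\<lambda>r s. (r, s) \<in> ordLeq"
  by (meson ordIso_ordLeq_trans ordIso_symmetric ordLeq_ordIso_trans)

lift_definition less_ordinal :: "'a ordinal \<Rightarrow> 'a ordinal \<Rightarrow> bool"
  is "\<lambda>r s. (r, s) \<in> ordLess"
  by (meson ordIso_ordLess_trans ordIso_symmetric ordLess_ordIso_trans)

instance
proof
  fix x y z :: "'a ordinal"
  show "x < y \<longleftrightarrow> x \<le> y \<and> \<not> y \<le> x"
    by transfer (meson not_ordLess_ordLeq not_ordLeq_iff_ordLess ordLess_imp_ordLeq)
  show "x \<le> x"
    by transfer (auto intro: ordLeq_reflexive)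
  show "x \<le> y \<Longrightarrow> y \<le> z \<Longrightarrow> x \<le> z"
    by transfer (rule ordLeq_transitive)
  show "x \<le> y \<Longrightarrow> y \<le> x \<Longrightarrow> x = y"
    by transfer (auto simp: ordIso_iff_ordLeq)
  show "x \<le> y \<or> y \<le> x"
    by transfer (auto intro: ordLeq_total[THEN disjE])
next
  fix Q :: "'a ordinal \<Rightarrow> bool" and a :: "'a ordinal"
  assume step: "\<And>x. (\<And>y. y < x \<Longrightarrow> Q y) \<Longrightarrow> Q x"
  have "wf {(x, y :: 'a ordinal). x < y}"
  proof (rule wf_subset)
    show "wf (inv_image ordLess (rep_ordinal :: 'a ordinal \<Rightarrow> 'a rel))"
      by (intro wf_inv_image wf_ordLess)
    show "{(x, y :: 'a ordinal). x < y} \<subseteq> inv_image ordLess rep_ordinal"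
      by (auto simp: less_ordinal.rep_eq)
  qed
  then show "Q a"
    by (induction a rule: wf_induct_rule) (auto intro: step)
qed

end

instantiation ordinal :: (type) zero
begin

lift_definition zero_ordinal :: "'a ordinal" is "{}"
  by (auto intro: ordIso_reflexive)

instance ..

end

definition osuc :: "'i ordinal \<Rightarrow> 'i ordinal"
  where "osuc \<delta> = (LEAST \<gamma>. \<delta> < \<gamma>)"

definition limit_ordinal :: "'i ordinal \<Rightarrow> bool"
  where "limit_ordinal \<delta> \<longleftrightarrow> \<delta> \<noteq> 0 \<and> (\<forall>\<beta>. \<delta> \<noteq> osuc \<beta>)"

definition omega :: "'i ordinal"
  where "omega = (LEAST \<delta>. infinite {..<\<delta>})"

lemma zero_le_ordinal: "(0 :: 'i ordinal) \<le> \<delta>"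
  by transfer (auto simp: ordLeq_def embed_def)

lemma exists_greater_ordinal: "\<exists>\<gamma>. (\<delta> :: 'i :: infinite ordinal) < \<gamma>"
proof (transfer, elim conjE)
  fix r :: "'i rel"
  assume r: "Well_order r"
  obtain g :: "'i \<Rightarrow> 'i" and c where g: "inj g" and c: "c \<notin> range g"
    using infinite_imp_bij_betw[OF infinite_UNIV[where 'a = 'i], of undefined]
    unfolding bij_betw_def by blast
  define p where "p = dir_image r g"
  have iso: "(r, p) \<in> ordIso" and p: "Well_order p"
    using r g unfolding p_def
    by (auto intro!: dir_image_ordIso Well_order_dir_image inj_on_subset[OF g])
  have "Field p \<subseteq> range g" unfolding p_def by (auto simp: dir_image_Field)
  with c have cp: "c \<notin> Field p" by blast
  define q where "q = p \<union> (insert c (Field p)) \<times> {c}"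
  have Fq: "Field q = insert c (Field p)"
    unfolding q_def Field_def by auto
  have pF: "(x, y) \<in> p \<Longrightarrow> x \<in> Field p \<and> y \<in> Field p" for x y
    by (auto simp: Field_def)
  have lin: "refl_on (Field p) p" "trans p" "antisym p" "total_on (Field p) p" "wf (p - Id)"
    using p by (auto simp: well_order_on_def linear_order_on_def partial_order_on_def preorder_on_def)
  have q: "Well_order q"
    unfolding well_order_on_def linear_order_on_def partial_order_on_def preorder_on_def
  proof (intro conjI)
    show "q \<subseteq> Field q \<times> Field q"
      by (auto simp: Field_def)
    show "refl_on (Field q) q"
      using lin(1) unfolding refl_on_def Fq unfolding q_def by blast
    show "trans q"
    proof (rule transI)
      fix x y z assume "(x, y) \<in> q" "(y, z) \<in> q"
      then show "(x, z) \<in> q"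
        using transD[OF lin(2)] pF cp unfolding q_def by blast
    qed
    show "antisym q"
    proof (rule antisymI)
      fix x y assume "(x, y) \<in> q" "(y, x) \<in> q"
      then show "x = y"
        using antisymD[OF lin(3)] pF cp unfolding q_def by blast
    qed
    show "total_on (Field q) q"
      using lin(4) unfolding total_on_def Fq unfolding q_def by blast
    have "wf ((p - Id) \<union> (Field p \<times> {c}))"
    proof (rule wf_Un)
      show "wf (Field p \<times> {c})"
        using cp by (intro wf_no_loop) (auto simp: relcomp_unfold)
      show "Domain (p - Id) \<inter> Range (Field p \<times> {c}) = {}"
        using cp pF by blast
    qed (rule lin(5))
    moreover have "q - Id = (p - Id) \<union> (Field p \<times> {c})"
      using cp unfolding q_def by auto
    ultimately show "wf (q - Id)" by simp
  qed
  have "underS q c = Field p"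
    using cp pF unfolding underS_def q_def by blast
  moreover have "Restr q (Field p) = p"
    using cp unfolding q_def by (auto dest: pF)
  ultimately have "(p, q) \<in> ordLess"
    using underS_Restr_ordLess[OF q, of c] Fq by auto
  then have "(r, q) \<in> ordLess"
    using iso ordIso_ordLess_trans by blast
  then show "\<exists>s\<in>{s :: 'i rel. Well_order s \<and> Well_order s \<and> (s, s) \<in> ordIso}. (r, s) \<in> ordLess"
    using q ordIso_reflexive[OF q] by blast
qed

lemma less_osuc: "\<delta> < osuc (\<delta> :: 'i :: infinite ordinal)"
  unfolding osuc_def by (rule LeastI_ex) (rule exists_greater_ordinal)

lemma less_osuc_iff: "\<beta> < osuc (\<delta> :: 'i :: infinite ordinal) \<longleftrightarrow> \<beta> \<le> \<delta>"
  by (metis less_osuc leD leI le_less_trans not_less_Least osuc_def)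

lemma osuc_inject: "osuc \<beta> = osuc (\<delta> :: 'i :: infinite ordinal) \<longleftrightarrow> \<beta> = \<delta>"
  by (metis less_osuc less_osuc_iff order.antisym)

lemma infinite_below_omega: "infinite {..<(omega :: 'i :: infinite ordinal)}"
proof -
  obtain g :: "nat \<Rightarrow> 'i" where g: "inj g"
    using infinite_countable_subset[OF infinite_UNIV[where 'a = 'i]] by blast
  define h :: "nat \<Rightarrow> 'i rel" where "h n = dir_image (natLeq_on n) g" for n
  have h: "Well_order (h n)" and iso: "(natLeq_on n, h n) \<in> ordIso" for n
    unfolding h_def using natLeq_on_Well_order
    by (auto intro!: dir_image_ordIso Well_order_dir_image inj_on_subset[OF g])
  define k :: "'i rel" where "k = dir_image natLeq g"
  have k: "Well_order k" and iso_k: "(natLeq, k) \<in> ordIso"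
    unfolding k_def using natLeq_Well_order
    by (auto intro!: dir_image_ordIso Well_order_dir_image inj_on_subset[OF g])
  have less: "(h m, h n) \<in> ordLess" if "m < n" for m n
  proof -
    have "(natLeq_on m, natLeq_on n) \<in> ordLess"
    proof -
      have "underS (natLeq_on n) m = {x. x < m}"
        using that by (auto simp: underS_def)
      moreover have "Restr (natLeq_on n) {x. x < m} = natLeq_on m"
        using that by auto
      moreover have "Field (natLeq_on n) \<noteq> {}"
        using that by (auto simp: Field_natLeq_on)
      ultimately show ?thesis
        using underS_Restr_ordLess[OF natLeq_on_Well_order[of n], of m] by simp
    qed
    then show ?thesis
      using iso by (meson ordIso_ordLess_trans ordIso_symmetric ordLess_ordIso_trans)
  qed
  have less_k: "(h n, k) \<in> ordLess" for n
  proof -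
    have "(natLeq_on n, natLeq) \<in> ordLess"
      using finite_ordLess_infinite[OF natLeq_on_Well_order natLeq_Well_order]
      by (simp add: Field_natLeq Field_natLeq_on)
    then show ?thesis
      using iso iso_k by (meson ordIso_ordLess_trans ordIso_symmetric ordLess_ordIso_trans)
  qed
  have abs_less: "abs_ordinal r < abs_ordinal s"
    if "Well_order r" "Well_order s" "(r, s) \<in> ordLess" for r s :: "'i rel"
    using that by (simp add: less_ordinal.abs_eq ordIso_reflexive)
  have "strict_mono (\<lambda>n. abs_ordinal (h n))"
    by (auto intro!: strict_monoI abs_less h less)
  then have "infinite (range (\<lambda>n. abs_ordinal (h n)))"
    by (simp add: finite_image_iff strict_mono_imp_inj_on)
  moreover have "range (\<lambda>n. abs_ordinal (h n)) \<subseteq> {..<abs_ordinal k}"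
    by (auto intro!: abs_less h k less_k)
  ultimately have "infinite {..<abs_ordinal k}"
    using finite_subset by blast
  then show ?thesis
    unfolding omega_def by (rule LeastI)
qed

lemma less_omega_iff: "\<delta> < (omega :: 'i :: infinite ordinal) \<longleftrightarrow> finite {..<\<delta>}"
proof
  show "\<delta> < omega \<Longrightarrow> finite {..<\<delta>}"
    unfolding omega_def using not_less_Least by blast
  show "finite {..<\<delta>} \<Longrightarrow> \<delta> < omega"
    using infinite_below_omega
    by (metis finite_subset lessThan_subset_iff not_le)
qed


section \<open>Transfinite iteration\<close>

function iterate :: "('a \<Rightarrow> 'a) \<Rightarrow> 'i :: infinite ordinal \<Rightarrow> 'a :: {ccpo, order_bot}"
  where "iterate f \<delta> =
    (if \<delta> = 0 then bot
     else if \<exists>\<beta>. \<delta> = osuc \<beta> then f (iterate f (THE \<beta>. \<delta> = osuc \<beta>))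
     else Sup ((\<lambda>\<beta>. iterate f \<beta>) ` {..<\<delta>}))"
  by pat_completeness auto
termination
proof (relation "inv_image {(\<beta>, \<delta>). \<beta> < \<delta>} snd")
  show "wf (inv_image {(\<beta>, \<delta> :: 'i ordinal). \<beta> < \<delta>} (snd :: ('a \<Rightarrow> 'a) \<times> _ \<Rightarrow> _))"
    by (intro wf_inv_image) (rule wf)
qed (auto simp: osuc_inject less_osuc)

declare iterate.simps [simp del]

lemma iterate_0: "iterate f 0 = bot"
  by (subst iterate.simps) simp

lemma iterate_osuc: "iterate f (osuc \<delta>) = f (iterate f \<delta>)"
proof -
  have "osuc \<delta> \<noteq> 0"
    using less_osuc[of \<delta>] zero_le_ordinal[of \<delta>] by auto
  then show ?thesis
    by (subst iterate.simps) (auto simp: osuc_inject)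
qed

lemma iterate_limit: "limit_ordinal \<delta> \<Longrightarrow> iterate f \<delta> = Sup (iterate f ` {..<\<delta>})"
  by (subst iterate.simps) (auto simp: limit_ordinal_def)


section \<open>Least upper bounds and well-founded sets\<close>

text \<open>
  In a \<open>ccpo\<close> the value \<open>Sup A\<close> is unconstrained when \<open>A\<close> is not a chain.  The terms of the
  sequence in the theorem need not form a chain, so its limit condition speaks of a least
  upper bound explicitly.
\<close>

definition is_lub :: "'a :: order set \<Rightarrow> 'a \<Rightarrow> bool"
  where "is_lub A s \<longleftrightarrow> (\<forall>x\<in>A. x \<le> s) \<and> (\<forall>z. (\<forall>x\<in>A. x \<le> z) \<longrightarrow> s \<le> z)"

definition strict_converse :: "('w \<Rightarrow> 'w \<Rightarrow> bool) \<Rightarrow> 'w \<Rightarrow> 'w \<Rightarrow> bool"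
  where "strict_converse le x y \<longleftrightarrow> le y x \<and> y \<noteq> x"

definition well_founded_set :: "'w set \<Rightarrow> ('w \<Rightarrow> 'w \<Rightarrow> bool) \<Rightarrow> bool"
  where "well_founded_set W le \<longleftrightarrow>
    \<not> (\<exists>w :: nat \<Rightarrow> 'w. (\<forall>n. w n \<in> W) \<and> (\<forall>n. strict_converse le (w n) (w (Suc n))))"

end

(* Only the finite ordinals matter.  If P were below no X n with n finite, the values \<nu> (X n)
   would form an infinite strictly decreasing chain in W. At every finite stage, induction
   gives X n \<le> f^n \<le> lfp f. *)

theory Submission
  imports Defs
begin

text \<open>Below \<open>omega\<close> lie exactly the ordinals with finitely many predecessors, and
  a successor gains just one new predecessor.\<close>

lemma osuc_less_omega:
  assumes "\<delta> < (omega :: 'i :: infinite ordinal)"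
  shows "osuc \<delta> < omega"
proof -
  have "{..<osuc \<delta>} = insert \<delta> {..<\<delta>}"
    by (auto simp: less_osuc_iff)
  with assms show ?thesis
    by (simp add: less_omega_iff)
qed

lemma funpow_osuc_less_omega: "(osuc ^^ n) 0 < (omega :: 'i :: infinite ordinal)"
proof (induction n)
  case 0
  have "{..<0 :: 'i ordinal} = {}"
    by (auto simp: zero_le_ordinal leD)
  then show ?case
    by (simp add: less_omega_iff)
qed (simp add: osuc_less_omega)

text \<open>For monotone \<open>f\<close>, \<open>fixp f\<close> is a fixpoint and lies below every
  \<open>x\<close> with \<open>f x \<le> x\<close>, in particular below every fixpoint. So
  \<open>LEAST\<close> really denotes a least fixpoint here.\<close>

lemma Least_fixpoint_eq_fixp:
  fixes f :: "'a :: ccpo \<Rightarrow> 'a"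
  assumes "mono f"
  shows "(LEAST x. f x = x) = ccpo_class.fixp f"
  using assms by (intro Least_equality) (auto simp: fixp_unfold[symmetric] intro: fixp_lowerbound)

theorem mainTheorem5:
  fixes f :: "'a :: {ccpo, order_bot} \<Rightarrow> 'a"
    and P :: 'a
    and X :: "'i :: infinite ordinal \<Rightarrow> 'a"
    and W :: "'w set"
    and le_W :: "'w \<Rightarrow> 'w \<Rightarrow> bool"
    and \<nu> :: "'a \<Rightarrow> 'w"
  assumes f_increasing: "mono f"
    and X_zero: "X 0 = bot"
    and X_succ: "\<And>\<delta>. X (osuc \<delta>) \<le> f (X \<delta>)"
    and X_limit: "\<And>\<delta>. limit_ordinal \<delta> \<Longrightarrow> \<exists>s. is_lub (X ` {..<\<delta>}) s \<and> X \<delta> \<le> s"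
    and W_wf: "well_founded_set W le_W"
    and \<nu>_range: "\<nu> ` range X \<subseteq> W"
    and \<nu>_decreasing:
      "\<And>\<beta> \<delta>. \<beta> < \<delta> \<Longrightarrow> \<not> P \<le> X \<beta> \<Longrightarrow> strict_converse le_W (\<nu> (X \<beta>)) (\<nu> (X \<delta>))"
  shows "\<exists>\<delta> < (omega :: 'i ordinal).
    P \<le> X \<delta> \<and> X \<delta> \<le> iterate f \<delta> \<and> iterate f \<delta> \<le> (LEAST x. f x = x)"
proof -
  \<comment> \<open>The finite ordinals, indexed by \<open>nat\<close> because a descending chain in
    \<open>well_founded_set\<close> is a sequence over \<open>nat\<close>.\<close>
  define fin where "fin n = ((osuc ^^ n) 0 :: 'i ordinal)" for n
  have fin_0: "fin 0 = 0" and fin_Suc: "fin (Suc n) = osuc (fin n)" for n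
    by (simp_all add: fin_def)
  have "\<exists>n. P \<le> X (fin n)"
  proof (rule ccontr)
    assume "\<nexists>n. P \<le> X (fin n)"
    \<comment> \<open>Each \<open>fin n\<close> is below its successor, so the failure of
      \<open>P \<le> X (fin n)\<close> forces a strict drop of \<open>\<nu>\<close> at every
      step.\<close>
    then have "strict_converse le_W (\<nu> (X (fin n))) (\<nu> (X (fin (Suc n))))" for n
      using \<nu>_decreasing by (simp add: fin_Suc less_osuc)
    moreover have "\<nu> (X (fin n)) \<in> W" for n
      using \<nu>_range by blast
    ultimately show False
      using W_wf unfolding well_founded_set_def
      by (auto dest: spec[of _ "\<lambda>n. \<nu> (X (fin n))"])
  qed
  then obtain n where "P \<le> X (fin n)" ..
  moreover have "X (fin n) \<le> iterate f (fin n)"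
  proof (induction n)
    case (Suc n)
    \<comment> \<open>The chain is \<open>X (osuc \<delta>) \<le> f (X \<delta>) \<le> f (iterate f
      \<delta>)\<close> with \<open>\<delta> = fin n\<close>; the second step is monotonicity
      applied to the induction hypothesis.\<close>
    then show ?case
      using X_succ[of "fin n"] monoD[OF f_increasing] by (auto simp: fin_Suc iterate_osuc intro: order_trans)
  qed (simp add: fin_0 X_zero)
  moreover have "iterate f (fin n) \<le> ccpo_class.fixp f"
  proof (induction n)
    case (Suc n)
    then have "f (iterate f (fin n)) \<le> f (ccpo_class.fixp f)"
      by (rule monoD[OF f_increasing])
    then show ?case
      using f_increasing by (simp add: fin_Suc iterate_osuc fixp_unfold[symmetric])
  qed (simp add: fin_0 iterate_0)
  moreover have "fin n < omega"
    unfolding fin_def by (rule funpow_osuc_less_omega)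
  ultimately show ?thesis
    using Least_fixpoint_eq_fixp[OF f_increasing] by auto
qed

end
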